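(* Let $(M_i)_{i\ge 1}$ be an increasing sequence of positive integers with $M_i\to\infty$, let $q_1=2$, $q_{i+1}=q_i^{M_i}$, and let $\phi:[2,\infty)\to(0,\infty)$ be monotone increasing with $\phi(t)\to\infty$. For each $i\ge1$ define $$G_i=\frac{1}{q_i}\big([0,q_i]\cap\mathbb Z\big),\qquad r_i=q_i^{-\phi(q_i)},\qquad E_i=\{x\in[0,1]:\operatorname{dist}(x,G_i)\le r_i\},\qquad E=\bigcap_{i=1}^\infty E_i.$$ Suppose there exist $\varepsilon>0$ and $C>0$ such that for all sufficiently large $n$, $$\prod_{j=1}^{n-1}\left(1+q_j^{M_j-\phi(q_j)}\right)\le C\left(\phi(q_{n-1})\log q_{n-1}\right)^{2-\varepsilon}.$$ Then $$\dim_P^{\log}(E)\le 2-\varepsilon.$$ In particular, $\dim_P^{\log}(E)<2$.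
   Context: $\dim_P^{\log}$ denotes logarithmic packing dimension, defined as follows. A gauge function is an increasing right-continuous $\psi:\mathbb R_{\ge0}\to\mathbb R_{\ge0}$ with $\psi(0)=0$ and $\psi(t)>0$ for $t>0$. A $\delta$-packing of a set $F$ is a collection of disjoint balls with centres in $F$ and radii less than $\delta$. The packing pre-measure is $$\mathcal P^\psi_0(F)=\lim_{\delta\to0}\sup\Big\{\sum_i\psi(r_i):\{B(x_i,r_i)\}_i\text{ is a }\delta\text{-packing of }F\Big\},$$ and the outer packing measure is $\mathcal P^\psi(F)=\inf\{\sum_i\mathcal P^\psi_0(F_i):F\subset\bigcup_iF_i\}$, the infimum being over countable covers. For $s>0$ let $h_s$ be a gauge function with $h_s(r)=(\log(1/r))^{-s}$ for sufficiently small $r>0$. Then $\dim_P^{\log}(F)$ is the infimum of all $s>0$ such that $\mathcal P^{h_s}(F)=0$. *)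

theory Defs
  imports "HOL-Analysis.Analysis"
begin

definition gauge_function :: "(real \<Rightarrow> real) \<Rightarrow> bool" where
  "gauge_function \<psi> \<longleftrightarrow>
     mono_on {0..} \<psi> \<and> (\<forall>t\<ge>0. continuous (at_right t) \<psi>) \<and> \<psi> 0 = 0 \<and> (\<forall>t>0. \<psi> t > 0)"

text \<open>A packing is given by its set of pairs (centre, radius); balls are closed, of positive radius.\<close>

definition is_packing :: "real \<Rightarrow> 'a::metric_space set \<Rightarrow> ('a \<times> real) set \<Rightarrow> bool" where
  "is_packing \<delta> F P \<longleftrightarrow>
     (\<forall>(x, r)\<in>P. x \<in> F \<and> 0 < r \<and> r < \<delta>) \<and> disjoint_family_on (\<lambda>(x, r). cball x r) P"

definition packing_sup :: "(real \<Rightarrow> real) \<Rightarrow> 'a::metric_space set \<Rightarrow> real \<Rightarrow> ennreal" where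
  "packing_sup \<psi> F \<delta> = (SUP P\<in>Collect (is_packing \<delta> F). \<Sum>\<^sub>\<infinity>(x, r)\<in>P. ennreal (\<psi> r))"

definition packing_premeasure :: "(real \<Rightarrow> real) \<Rightarrow> 'a::metric_space set \<Rightarrow> ennreal" where
  "packing_premeasure \<psi> F = Lim (at_right 0) (packing_sup \<psi> F)"

definition packing_measure :: "(real \<Rightarrow> real) \<Rightarrow> 'a::metric_space set \<Rightarrow> ennreal" where
  "packing_measure \<psi> F =
     (INF A\<in>{A :: nat \<Rightarrow> 'a set. F \<subseteq> (\<Union>i. A i)}. \<Sum>i. packing_premeasure \<psi> (A i))"

text \<open>A concrete choice of \<open>h\<^sub>s\<close>. Any other gauge function with the same values near \<open>0\<close> yields the same
  packing measure, see \<open>packing_measure_cong\<close> below.\<close>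

definition log_gauge :: "real \<Rightarrow> real \<Rightarrow> real" where
  "log_gauge s r = (if r \<le> 0 then 0 else if r < exp (-1) then ln (1 / r) powr (-s) else 1)"

text \<open>Valued in \<open>ereal\<close>, so that the infimum of the empty set is \<open>\<infinity>\<close>.\<close>

definition log_packing_dim :: "'a::metric_space set \<Rightarrow> ereal" where
  "log_packing_dim F = (INF s\<in>{s :: real. s > 0 \<and> packing_measure (log_gauge s) F = 0}. ereal s)"

lemma packing_sup_mono: "\<delta> \<le> \<delta>' \<Longrightarrow> packing_sup \<psi> F \<delta> \<le> packing_sup \<psi> F \<delta>'"
  unfolding packing_sup_def by (rule SUP_subset_mono) (force simp: is_packing_def)+

lemma packing_premeasure_tendsto:
  "(packing_sup \<psi> F \<longlongrightarrow> (INF \<delta>\<in>{0<..}. packing_sup \<psi> F \<delta>)) (at_right 0)"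
proof (rule order_tendstoI)
  fix a assume a: "a < (INF \<delta>\<in>{0<..}. packing_sup \<psi> F \<delta>)"
  have "\<forall>\<^sub>F \<delta> in at_right 0. (0::real) < \<delta>"
    by (simp add: eventually_at_right_less)
  then show "\<forall>\<^sub>F \<delta> in at_right 0. a < packing_sup \<psi> F \<delta>"
    by (rule eventually_mono) (auto intro: less_le_trans[OF a] INF_lower)
next
  fix a assume "(INF \<delta>\<in>{0<..}. packing_sup \<psi> F \<delta>) < a"
  then obtain d where d: "d > 0" "packing_sup \<psi> F d < a"
    by (auto simp: INF_less_iff)
  have "\<forall>\<^sub>F \<delta> in at_right 0. \<delta> < d"
    using d(1) by (simp add: eventually_at_right_field) blast
  then show "\<forall>\<^sub>F \<delta> in at_right 0. packing_sup \<psi> F \<delta> < a"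
    by (rule eventually_mono) (auto intro: le_less_trans[OF packing_sup_mono d(2)])
qed

lemma packing_premeasure_eq_INF:
  "packing_premeasure \<psi> F = (INF \<delta>\<in>{0<..}. packing_sup \<psi> F \<delta>)"
  unfolding packing_premeasure_def
  by (rule tendsto_Lim[OF _ packing_premeasure_tendsto]) simp

lemma packing_measure_cong:
  assumes "\<forall>\<^sub>F r in at_right 0. \<psi> r = \<psi>' r"
  shows "packing_measure \<psi> F = packing_measure \<psi>' F"
proof -
  obtain d where d: "d > 0" "\<And>r. 0 < r \<Longrightarrow> r < d \<Longrightarrow> \<psi> r = \<psi>' r"
    using assms by (auto simp: eventually_at_right_field)
  have eq: "packing_sup \<psi> A \<delta> = packing_sup \<psi>' A \<delta>" if "\<delta> < d" for A :: "'a set" and \<delta>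
    unfolding packing_sup_def
    by (intro SUP_cong refl infsum_cong) (use that d(2) in \<open>force simp: is_packing_def\<close>)
  have ev: "\<forall>\<^sub>F \<delta> in at_right 0. \<delta> < d"
    using d(1) by (simp add: eventually_at_right_field) blast
  have "packing_premeasure \<psi> A = packing_premeasure \<psi>' A" for A :: "'a set"
  proof -
    have "(packing_sup \<psi>' A \<longlongrightarrow> packing_premeasure \<psi> A) (at_right 0)"
      using packing_premeasure_tendsto[of \<psi> A]
      unfolding packing_premeasure_eq_INF[symmetric]
      by (rule Lim_transform_eventually) (use ev eq in \<open>auto elim: eventually_mono\<close>)
    then show ?thesis
      unfolding packing_premeasure_def[of \<psi>'] by (intro tendsto_Lim[symmetric]) simp_all
  qed
  then show ?thesis by (simp add: packing_measure_def)
qed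

lemma log_gauge_eventually: "\<forall>\<^sub>F r in at_right 0. log_gauge s r = ln (1 / r) powr (-s)"
  unfolding eventually_at_right_field
  by (rule exI[of _ "exp (-1)"]) (auto simp: log_gauge_def)

lemma gauge_function_log_gauge:
  assumes s: "s > 0"
  shows "gauge_function (log_gauge s)"
proof -
  have ln_gt: "ln (1 / r) > 1" if "0 < r" "r < exp (-1)" for r :: real
    using that ln_less_cancel_iff[of r "exp (-1)"] by (simp add: ln_div)
  have small: "ln (1 / r) powr (-s) \<le> ln (1 / t) powr (-s)"
    if "0 < r" "r \<le> t" "t < exp (-1)" for r t :: real
  proof (rule powr_mono2')
    show "0 < ln (1 / t)" using ln_gt[of t] that by linarith
    show "ln (1 / t) \<le> ln (1 / r)" using that by (simp add: ln_div)
  qed (use s in simp)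
  have le1: "ln (1 / r) powr (-s) \<le> 1" if "0 < r" "r < exp (-1)" for r :: real
    using powr_mono2'[of "-s" 1 "ln (1 / r)"] ln_gt[OF that] s by simp
  have mono: "mono_on {0..} (log_gauge s)"
    by (rule mono_onI) (auto simp: log_gauge_def intro: small le1)
  have pos: "log_gauge s t > 0" if "t > 0" for t
    using ln_gt[of t] that by (auto simp: log_gauge_def)
  have cont: "continuous (at_right t) (log_gauge s)" if t: "t \<ge> 0" for t
  proof -
    consider "t = 0" | "0 < t" "t < exp (-1)" | "t \<ge> exp (-1)"
      using t by fastforce
    then show ?thesis
    proof cases
      case 1
      have "filterlim (\<lambda>r::real. ln (inverse r)) at_top (at_right 0)"
        by (rule filterlim_compose[OF ln_at_top filterlim_inverse_at_top_right])
      then have "((\<lambda>r. ln (1 / r) powr (-s)) \<longlongrightarrow> 0) (at_right 0)"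
        using s by (intro tendsto_neg_powr) (simp_all add: inverse_eq_divide)
      then have "(log_gauge s \<longlongrightarrow> 0) (at_right 0)"
        by (rule Lim_transform_eventually)
          (use log_gauge_eventually[of s] in \<open>auto elim: eventually_mono\<close>)
      then show ?thesis
        using 1 by (simp add: continuous_within log_gauge_def)
    next
      case 2
      have "((\<lambda>r. ln (1 / r) powr (-s)) \<longlongrightarrow> ln (1 / t) powr (-s)) (at_right t)"
        using 2 ln_gt[OF 2] by (intro tendsto_intros) auto
      moreover have "\<forall>\<^sub>F r in at_right t. ln (1 / r) powr (-s) = log_gauge s r"
        unfolding eventually_at_right_field
        by (rule exI[of _ "exp (-1)"]) (use 2 in \<open>auto simp: log_gauge_def\<close>)
      ultimately have "(log_gauge s \<longlongrightarrow> ln (1 / t) powr (-s)) (at_right t)"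
        by (rule Lim_transform_eventually)
      then show ?thesis
        using 2 by (simp add: continuous_within log_gauge_def)
    next
      case 3
      then have t0: "t > 0" by (rule less_le_trans[OF exp_gt_zero])
      have "\<forall>\<^sub>F r in at_right t. 1 = log_gauge s r"
        unfolding eventually_at_right_field
        by (rule exI[of _ "t + 1"]) (use 3 t0 in \<open>auto simp: log_gauge_def\<close>)
      then have "(log_gauge s \<longlongrightarrow> 1) (at_right t)"
        by (rule Lim_transform_eventually[OF tendsto_const])
      then show ?thesis
        using 3 t0 by (simp add: continuous_within log_gauge_def)
    qed
  qed
  show ?thesis
    unfolding gauge_function_def using mono cont pos by (simp add: log_gauge_def)
qed

end

theory Submission
  imports Defs
begin

text \<open>
  Put \<open>L\<^sub>k = \<phi>(q\<^sub>k) ln q\<^sub>k\<close>, so that \<open>r\<^sub>k = exp (- L\<^sub>k)\<close>. An interval of radius \<open>2 r\<^sub>k\<close> meets at most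
  \<open>1 + 4 r\<^sub>k q\<^sub>k\<^sub>+\<^sub>1\<close> points of \<open>G\<^sub>k\<^sub>+\<^sub>1\<close>, hence \<open>E\<close> is covered by \<open>O(4\<^sup>k L\<^sub>k powr (2 - \<epsilon>))\<close> intervals of
  radius \<open>r\<^sub>k\<^sub>+\<^sub>1\<close>. Disjoint balls with radii in \<open>[r\<^sub>k\<^sub>+\<^sub>1, r\<^sub>k)\<close> and centres in \<open>E\<close> have their centres in different
  intervals, and each contributes at most \<open>L\<^sub>k powr (- s)\<close> to the packing sum. For \<open>s > 2 - \<epsilon>\<close> the bounds
  \<open>4\<^sup>k L\<^sub>k powr (2 - \<epsilon> - s)\<close> are summable, because \<open>L\<^sub>k\<^sub>+\<^sub>1 \<ge> M\<^sub>k L\<^sub>k\<close> with \<open>M\<^sub>k \<rightarrow> \<infinity>\<close> makes \<open>L\<^sub>k\<close> grow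
  superexponentially; their tails vanish, so already the packing pre-measure of \<open>E\<close> is zero.
\<close>

section \<open>Packing sums controlled by covers\<close>

lemma log_gauge_le_of_less_exp:
  assumes "s > 0" "L > 1" "0 < t" "t < exp (- L)"
  shows "log_gauge s t \<le> L powr (- s)"
proof -
  have "mono_on {0..} (log_gauge s)"
    using gauge_function_log_gauge[OF assms(1)] by (simp add: gauge_function_def)
  then have "log_gauge s t \<le> log_gauge s (exp (- L))"
    using assms by (intro mono_onD[of "{0..}" "log_gauge s"]) auto
  \<comment> \<open>\<open>L > 1\<close> places \<open>exp (- L)\<close> strictly inside the
    logarithmic branch of \<open>log_gauge\<close>.\<close>
  also have "\<dots> = L powr (- s)"
    using assms(2) by (simp add: log_gauge_def exp_minus inverse_eq_divide[symmetric])
  finally show ?thesis .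
qed

lemma log_gauge_nonneg: "log_gauge s t \<ge> 0"
  by (simp add: log_gauge_def)

lemma is_packing_subset: "is_packing \<delta> F P \<Longrightarrow> Q \<subseteq> P \<Longrightarrow> is_packing \<delta> F Q"
  unfolding is_packing_def using disjoint_family_on_mono by blast

text \<open>Send each packing ball to a cover point within \<open>\<rho>\<close> of its centre. As
  the radius is at least \<open>\<rho>\<close>, that point lies in the ball, so disjointness makes
  the map injective.\<close>

lemma card_packing_le_card_cover:
  fixes P :: "('a::metric_space \<times> real) set"
  assumes P: "is_packing \<delta> F P" "\<And>x t. (x, t) \<in> P \<Longrightarrow> \<rho> \<le> t"
    and S: "finite S" "F \<subseteq> (\<Union>g\<in>S. cball g \<rho>)"
  shows "card P \<le> card S"
proof -
  have "\<exists>g\<in>S. dist g (fst p) \<le> \<rho>" if "p \<in> P" for p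
  proof -
    have "fst p \<in> F" using P(1) that by (auto simp: is_packing_def)
    then obtain g where "g \<in> S" "fst p \<in> cball g \<rho>" using S(2) by blast
    then show ?thesis by auto
  qed
  then obtain f where f: "\<And>p. p \<in> P \<Longrightarrow> f p \<in> S" "\<And>p. p \<in> P \<Longrightarrow> dist (f p) (fst p) \<le> \<rho>"
    by metis
  have "inj_on f P"
  proof (rule inj_onI, rule ccontr)
    fix p p' assume p: "p \<in> P" "p' \<in> P" "f p = f p'" "p \<noteq> p'"
    obtain x t x' t' where [simp]: "p = (x, t)" "p' = (x', t')" by (meson surj_pair)
    have "cball x t \<inter> cball x' t' = {}"
      using P(1) p(4) disjoint_family_onD[OF _ p(1,2), of "\<lambda>(x, t). cball x t"]
      by (simp add: is_packing_def)
    moreover have "f p \<in> cball x t"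
      using f(2)[OF p(1)] P(2)[of x t] p(1) by (simp add: dist_commute)
    moreover have "f p \<in> cball x' t'"
      using f(2)[OF p(2)] P(2)[of x' t'] p(2,3) by (simp add: dist_commute)
    ultimately show False by blast
  qed
  moreover have "f ` P \<subseteq> S" using f(1) by auto
  ultimately show ?thesis using S(1) by (rule card_inj_on_le)
qed

text \<open>Sort the balls by the level k at which the radius lies between
  \<open>exp (- L (Suc k))\<close> and \<open>exp (- L k)\<close>. Level k holds at most
  \<open>N k\<close> balls, each of weight at most \<open>L k powr (- s)\<close>, so packings finer
  than \<open>exp (- L n)\<close> are bounded by a tail of the convergent series.\<close>

lemma packing_measure_log_gauge_eq_0:
  fixes F :: "'a::metric_space set" and L N :: "nat \<Rightarrow> real"
  assumes s: "s > 0" and L: "filterlim L at_top sequentially"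
    and cover: "\<forall>\<^sub>F k in sequentially. \<exists>S. finite S \<and> real (card S) \<le> N k \<and>
                  F \<subseteq> (\<Union>g\<in>S. cball g (exp (- L (Suc k))))"
    and summ: "summable (\<lambda>k. N k * L k powr (- s))"
  shows "packing_measure (log_gauge s) F = 0"
proof -
  define a where "a k = N k * L k powr (- s)" for k
  obtain n1 where n1: "\<And>k. k \<ge> n1 \<Longrightarrow> L k > 1 \<and> (\<exists>S. finite S \<and> real (card S) \<le> N k \<and>
                  F \<subseteq> (\<Union>g\<in>S. cball g (exp (- L (Suc k)))))"
    using eventually_conj[OF filterlim_at_top_dense[THEN iffD1, OF L, rule_format, of 1] cover]
    by (auto simp: eventually_sequentially)
  \<comment> \<open>Nonnegative terms allow the sum over the occurring levels to be extended to the
    whole tail below.\<close>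
  have N0: "N k \<ge> 0" if "k \<ge> n1" for k
    using n1[OF that] by (auto intro: order_trans[OF of_nat_0_le_iff])
  have bound: "packing_sup (log_gauge s) F (exp (- L n)) \<le> ennreal (\<Sum>i. a (i + n))" if n: "n \<ge> n1" for n
  proof -
    have sa: "summable (\<lambda>i. a (i + n))"
      using summ unfolding a_def by (rule summable_ignore_initial_segment)
    have fin: "(\<Sum>p\<in>H. log_gauge s (snd p)) \<le> (\<Sum>i. a (i + n))"
      if H: "finite H" "is_packing (exp (- L n)) F H" for H
    proof -
      have lev: "\<exists>i. exp (- L (Suc (i + n))) \<le> t \<and> t < exp (- L (i + n))"
        if t: "0 < t" "t < exp (- L n)" for t
      proof -
        \<comment> \<open>\<open>L\<close> need not be monotone, so the level is taken just before
          the first threshold that is at most t.\<close>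
        define Q where "Q j \<longleftrightarrow> exp (- L (j + n)) \<le> t" for j
        have "\<forall>\<^sub>F k in sequentially. - ln t \<le> L k"
          using L by (simp add: filterlim_at_top)
        then obtain k where "- ln t \<le> L (k + n)"
          unfolding eventually_sequentially using le_add1 by blast
        then have "exp (- L (k + n)) \<le> exp (ln t)" by (subst exp_le_cancel_iff) simp
        then have "Q k" using t by (simp add: Q_def)
        moreover have "\<not> Q 0" using t by (simp add: Q_def)
        ultimately obtain i where "\<not> Q i" "Q (Suc i)"
          using ex_least_nat_less[of Q k] by auto
        then show ?thesis by (auto simp: Q_def)
      qed
      have "\<exists>i. exp (- L (Suc (i + n))) \<le> snd p \<and> snd p < exp (- L (i + n))" if "p \<in> H" for p
        using lev[of "snd p"] H(2) that by (auto simp: is_packing_def)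
      then obtain l where l: "\<And>p. p \<in> H \<Longrightarrow> exp (- L (Suc (l p + n))) \<le> snd p"
           "\<And>p. p \<in> H \<Longrightarrow> snd p < exp (- L (l p + n))" by metis
      have lvl: "(\<Sum>p\<in>{p\<in>H. l p = i}. log_gauge s (snd p)) \<le> a (i + n)" for i
      proof -
        let ?Hi = "{p\<in>H. l p = i}"
        obtain S where S: "finite S" "real (card S) \<le> N (i + n)"
            "F \<subseteq> (\<Union>g\<in>S. cball g (exp (- L (Suc (i + n)))))" and L1: "L (i + n) > 1"
          using n1[of "i + n"] n by (auto simp: trans_le_add2)
        have "is_packing (exp (- L n)) F ?Hi"
          by (rule is_packing_subset[OF H(2)]) auto
        then have "card ?Hi \<le> card S"
          by (rule card_packing_le_card_cover[OF _ _ S(1,3)]) (use l(1) in fastforce)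
        moreover have "(\<Sum>p\<in>?Hi. log_gauge s (snd p)) \<le> real (card ?Hi) * L (i + n) powr (- s)"
        proof (rule sum_bounded_above)
          fix p assume p: "p \<in> ?Hi"
          then have "0 < snd p" using H(2) by (auto simp: is_packing_def)
          then show "log_gauge s (snd p) \<le> L (i + n) powr (- s)"
            using log_gauge_le_of_less_exp[OF s L1] l(2)[of p] p by auto
        qed
        moreover have "real (card ?Hi) * L (i + n) powr (- s) \<le> N (i + n) * L (i + n) powr (- s)"
          using calculation(1) S(2) by (intro mult_right_mono) auto
        ultimately show ?thesis by (simp add: a_def)
      qed
      have "(\<Sum>p\<in>H. log_gauge s (snd p)) = (\<Sum>i\<in>l ` H. \<Sum>p\<in>{p\<in>H. l p = i}. log_gauge s (snd p))"
        by (rule sum.image_gen[OF H(1)])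
      also have "\<dots> \<le> (\<Sum>i\<in>l ` H. a (i + n))"
        by (intro sum_mono lvl)
      also have "\<dots> \<le> (\<Sum>i. a (i + n))"
        using H(1) N0 n by (intro sum_le_suminf[OF sa]) (auto simp: a_def)
      finally show ?thesis .
    qed
    show ?thesis
      unfolding packing_sup_def
    proof (rule SUP_least)
      fix P assume P: "P \<in> Collect (is_packing (exp (- L n)) F)"
      show "(\<Sum>\<^sub>\<infinity>(x, t)\<in>P. ennreal (log_gauge s t)) \<le> ennreal (\<Sum>i. a (i + n))"
      \<comment> \<open>Finite subfamilies suffice: they are packings again, and their real sums
        avoid convergence questions for \<open>P\<close>.\<close>
      proof (rule infsum_le_finite_sums)
        fix H assume H: "finite H" "H \<subseteq> P"
        then have "is_packing (exp (- L n)) F H"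
          using P by (auto intro: is_packing_subset)
        then have "ennreal (\<Sum>p\<in>H. log_gauge s (snd p)) \<le> ennreal (\<Sum>i. a (i + n))"
          by (intro ennreal_leI fin H)
        then show "(\<Sum>(x, t)\<in>H. ennreal (log_gauge s t)) \<le> ennreal (\<Sum>i. a (i + n))"
          by (simp add: case_prod_unfold sum_ennreal log_gauge_nonneg)
      qed (rule nonneg_summable_on_complete, simp)
    qed
  qed
  have "packing_premeasure (log_gauge s) F \<le> ennreal e" if "e > 0" for e
  proof -
    have "(\<lambda>n. \<Sum>i. a (i + n)) \<longlonglongrightarrow> 0"
      using summ unfolding a_def by (rule suminf_exist_split2)
    then have "\<forall>\<^sub>F n in sequentially. (\<Sum>i. a (i + n)) < e"
      using that by (rule order_tendstoD)
    then obtain n where "n \<ge> n1" "(\<Sum>i. a (i + n)) < e"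
      using eventually_happens'[OF _ eventually_conj[OF _ eventually_ge_at_top[of n1]]] by auto
    then have "packing_sup (log_gauge s) F (exp (- L n)) \<le> ennreal e"
      by (intro order_trans[OF bound] ennreal_leI) auto
    then show ?thesis
      unfolding packing_premeasure_eq_INF by (rule INF_lower2[rotated]) simp
  qed
  then have "packing_premeasure (log_gauge s) F = 0"
    using ennreal_le_epsilon[of 0 "packing_premeasure (log_gauge s) F"] by simp
  \<comment> \<open>The constant cover by \<open>F\<close> is used; all its terms are zero.\<close>
  moreover have "packing_measure (log_gauge s) F \<le> (\<Sum>i::nat. packing_premeasure (log_gauge s) F)"
    unfolding packing_measure_def by (rule INF_lower) auto
  ultimately show ?thesis by simp
qed

section \<open>Summability and lattice point counts\<close>

lemma summable_power_times_powr_neg: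
  fixes L m :: "nat \<Rightarrow> real"
  assumes pos: "\<forall>\<^sub>F k in sequentially. L k > 0"
    and growth: "\<forall>\<^sub>F k in sequentially. m k * L k \<le> L (Suc k)"
    and m: "filterlim m at_top sequentially" and "c \<ge> 0" "\<eta> > 0"
  shows "summable (\<lambda>k. c ^ k * L k powr (- \<eta>))"
proof -
  \<comment> \<open>This expression bounds the ratio of consecutive terms, so the ratio test applies
    with 1/2 for large k.\<close>
  have "(\<lambda>k. c * m k powr (- \<eta>)) \<longlonglongrightarrow> c * 0"
    using assms(5) by (intro tendsto_intros tendsto_neg_powr m) simp
  then have "\<forall>\<^sub>F k in sequentially. c * m k powr (- \<eta>) < 1 / 2"
    by (rule order_tendstoD) simp
  moreover have "\<forall>\<^sub>F k in sequentially. m k > 0"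
    using m by (simp add: filterlim_at_top_dense)
  ultimately have "\<forall>\<^sub>F k in sequentially.
      norm (c ^ Suc k * L (Suc k) powr (- \<eta>)) \<le> 1 / 2 * norm (c ^ k * L k powr (- \<eta>))"
    using pos growth
  proof eventually_elim
    case (elim k)
    have "L (Suc k) powr (- \<eta>) \<le> (m k * L k) powr (- \<eta>)"
      using elim assms(5) by (intro powr_mono2') auto
    then have "c ^ Suc k * L (Suc k) powr (- \<eta>) \<le> c ^ Suc k * (m k * L k) powr (- \<eta>)"
      using assms(4) by (intro mult_left_mono) auto
    also have "\<dots> = (c * m k powr (- \<eta>)) * (c ^ k * L k powr (- \<eta>))"
      using elim by (simp add: powr_mult)
    also have "\<dots> \<le> 1 / 2 * (c ^ k * L k powr (- \<eta>))"
      using elim assms(4) by (intro mult_right_mono) auto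
    finally show ?case using assms(4) by simp
  qed
  then obtain K where "\<And>k. k \<ge> K \<Longrightarrow>
      norm (c ^ Suc k * L (Suc k) powr (- \<eta>)) \<le> 1 / 2 * norm (c ^ k * L k powr (- \<eta>))"
    by (auto simp: eventually_sequentially)
  then show ?thesis by (intro summable_ratio_test[of "1 / 2"]) auto
qed

text \<open>After scaling by \<open>c\<close>, the points become integers in an interval of length
  \<open>2 * R * c\<close>.\<close>

lemma card_scaled_ints_near:
  fixes c y R :: real
  assumes c: "c > 0" and R: "R \<ge> 0"
  defines "A \<equiv> {g \<in> (\<lambda>x. 1 / c * x) ` \<int>. dist y g \<le> R}"
  shows "finite A" "real (card A) \<le> 1 + 2 * R * c"
proof -
  let ?I = "{\<lceil>c * (y - R)\<rceil>..\<lfloor>c * (y + R)\<rfloor>}"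
  have sub: "A \<subseteq> (\<lambda>k. 1 / c * of_int k) ` ?I"
  proof
    fix g assume "g \<in> A"
    then obtain k where k: "g = of_int k / c" "\<bar>y - g\<bar> \<le> R"
      by (auto simp: A_def Ints_def dist_real_def)
    then have "c * (y - R) \<le> of_int k" "of_int k \<le> c * (y + R)"
      using c mult_left_mono[of "y - R" g c] mult_left_mono[of g "y + R" c]
      by (simp_all add: abs_le_iff)
    then have "k \<in> ?I" by (simp add: ceiling_le_iff le_floor_iff)
    then show "g \<in> (\<lambda>k. 1 / c * of_int k) ` ?I" using k(1) by auto
  qed
  then show "finite A" by (rule finite_subset) simp
  have "card A \<le> card ?I"
    by (rule order_trans[OF card_mono[OF _ sub] card_image_le]) auto
  moreover have "real (card ?I) \<le> 1 + 2 * R * c"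
  \<comment> \<open>In the first case the cardinality formula is not truncated at 0; in the second
    the integer interval is empty.\<close>
  proof (cases "\<lceil>c * (y - R)\<rceil> \<le> \<lfloor>c * (y + R)\<rfloor> + 1")
    case True
    then have "real (card ?I) = of_int (\<lfloor>c * (y + R)\<rfloor> - \<lceil>c * (y - R)\<rceil> + 1)" by simp
    also have "\<dots> \<le> c * (y + R) - c * (y - R) + 1" by (simp, linarith)
    finally show ?thesis by (simp add: algebra_simps)
  qed (use c R in auto)
  ultimately show "real (card A) \<le> 1 + 2 * R * c" by linarith
qed

theorem proposition2p10:
  fixes M q :: "nat \<Rightarrow> nat" and \<phi> :: "real \<Rightarrow> real"
    and G E\<^sub>i :: "nat \<Rightarrow> real set" and r :: "nat \<Rightarrow> real" and E :: "real set"
    and \<epsilon> C :: real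
  assumes "\<forall>i\<ge>1. M i > 0"
    and "mono_on {1..} M"
    and "filterlim M at_top sequentially"
    and "q 1 = 2"
    and "\<forall>i\<ge>1. q (i + 1) = q i ^ M i"
    and "\<forall>t\<ge>2. \<phi> t > 0"
    and "mono_on {2..} \<phi>"
    and "filterlim \<phi> at_top at_top"
    and "\<forall>i\<ge>1. G i = (\<lambda>x. 1 / real (q i) * x) ` ({0..real (q i)} \<inter> \<int>)"
    and "\<forall>i\<ge>1. r i = real (q i) powr (- \<phi> (real (q i)))"
    and "\<forall>i\<ge>1. E\<^sub>i i = {x \<in> {0..1}. infdist x (G i) \<le> r i}"
    and "E = (\<Inter>i\<in>{1..}. E\<^sub>i i)"
    and "\<epsilon> > 0"
    and "C > 0"
    and "\<forall>\<^sub>F n in sequentially.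
           (\<Prod>j = 1..n - 1. 1 + real (q j) powr (real (M j) - \<phi> (real (q j))))
             \<le> C * (\<phi> (real (q (n - 1))) * ln (real (q (n - 1)))) powr (2 - \<epsilon>)"
  shows "log_packing_dim E \<le> ereal (2 - \<epsilon>) \<and> log_packing_dim E < 2"
proof -
  define L where "L i = \<phi> (real (q i)) * ln (real (q i))" for i
  define K where "K n = (\<Prod>j = 1..n - 1. 1 + real (q j) powr (real (M j) - \<phi> (real (q j))))" for n

  \<comment> \<open>Growth of \<open>q\<close> and \<open>L\<close>\<close>
  have q2: "real (q i) \<ge> 2" if "i \<ge> 1" for i
    using that
  proof (induction i rule: dec_induct)
    case base
    then show ?case using assms(4) by simp
  next
    case (step i)
    then have "q i ^ 1 \<le> q i ^ M i"
      using assms(1) by (intro power_increasing) (auto simp: Suc_le_eq)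
    then have "q i \<le> q (i + 1)" using step assms(5) by simp
    then show ?case using step by simp
  qed
  have qSuc: "q (Suc i) = q i ^ M i" if "i \<ge> 1" for i
    using assms(5) that by simp
  have Mpos: "M i \<ge> 1" if "i \<ge> 1" for i
    using assms(1) that by (simp add: Suc_le_eq)
  have phi_pos: "\<phi> (real (q i)) > 0" if "i \<ge> 1" for i
    using assms(6) q2[OF that] by simp
  have Lpos: "L i > 0" if "i \<ge> 1" for i
    using phi_pos[OF that] q2[OF that] by (simp add: L_def)
  \<comment> \<open>The factor \<open>M i\<close> comes from the logarithm of
    \<open>q i ^ M i\<close>; the factor \<open>\<phi>\<close> can only increase.\<close>
  have Lgrow: "real (M i) * L i \<le> L (Suc i)" if i: "i \<ge> 1" for i
  proof -
    have "q i ^ 1 \<le> q i ^ M i"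
      using Mpos[OF i] q2[OF i] by (intro power_increasing) auto
    then have "real (q i) \<le> real (q (Suc i))" using qSuc[OF i] by simp
    then have "\<phi> (real (q i)) \<le> \<phi> (real (q (Suc i)))"
      using q2[of i] q2[of "Suc i"] i by (intro mono_onD[OF assms(7)]) auto
    moreover have "ln (real (q (Suc i))) = real (M i) * ln (real (q i))"
      using q2[OF i] by (simp add: qSuc[OF i] ln_realpow)
    ultimately show ?thesis
      using q2[OF i] by (simp add: L_def mult_right_mono mult.left_commute[of "real (M i)"])
  qed
  have summ: "summable (\<lambda>k. c ^ k * L k powr (- \<eta>))" if "c \<ge> 0" "\<eta> > 0" for c \<eta>
  proof (rule summable_power_times_powr_neg[OF _ _ _ that])
    show "\<forall>\<^sub>F k in sequentially. L k > 0"
      using Lpos by (auto simp: eventually_sequentially)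
    show "\<forall>\<^sub>F k in sequentially. real (M k) * L k \<le> L (Suc k)"
      using Lgrow by (auto simp: eventually_sequentially)
    show "filterlim (\<lambda>k. real (M k)) at_top sequentially"
      by (rule filterlim_compose[OF filterlim_real_sequentially assms(3)])
  qed
  \<comment> \<open>With c = \<eta> = 1, the reciprocals of \<open>L\<close> are summable and hence
    tend to 0.\<close>
  have Llim: "filterlim L at_top sequentially"
  proof -
    have "\<forall>\<^sub>F k in sequentially. 1 ^ k * L k powr (- 1) = inverse (L k)"
      unfolding eventually_sequentially
      by (rule exI[of _ 1]) (auto simp: powr_minus Lpos less_imp_le)
    then have "(\<lambda>k. inverse (L k)) \<longlonglongrightarrow> 0"
      using summable_LIMSEQ_zero[OF summ[of 1 1]] by (auto intro: Lim_transform_eventually)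
    moreover have "\<forall>\<^sub>F k in sequentially. inverse (L k) > 0"
      using Lpos by (auto simp: eventually_sequentially)
    ultimately have "filterlim (\<lambda>k. inverse (inverse (L k))) at_top sequentially"
      by (rule filterlim_inverse_at_top)
    then show ?thesis by simp
  qed
  have req: "r i = exp (- L i)" if "i \<ge> 1" for i
    using assms(10) q2[OF that] that by (simp add: powr_def L_def)
  have rmono: "r (Suc i) \<le> r i" if i: "i \<ge> 1" for i
  proof -
    have "1 * L i \<le> real (M i) * L i"
      using Mpos[OF i] Lpos[OF i] by (intro mult_right_mono) auto
    then show ?thesis using Lgrow[OF i] i by (simp add: req)
  qed
  have Kge: "K n \<ge> 1" for n
    unfolding K_def by (rule prod_ge_1) simp
  have Kb: "\<forall>\<^sub>F n in sequentially. K n \<le> C * L (n - 1) powr (2 - \<epsilon>)"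
    using assms(15) by (simp add: K_def L_def)
  then have Kb': "\<forall>\<^sub>F k in sequentially. K (Suc k) \<le> C * L k powr (2 - \<epsilon>)"
    by (subst (asm) eventually_sequentially_Suc[symmetric]) simp
  \<comment> \<open>Needed since \<open>log_packing_dim\<close> only ranges over positive exponents and hence is never negative.\<close>
  have eps2: "\<epsilon> \<le> 2"
  proof (rule ccontr)
    assume "\<not> \<epsilon> \<le> 2"
    then have "(\<lambda>k. C * L k powr (2 - \<epsilon>)) \<longlonglongrightarrow> C * 0"
      by (intro tendsto_intros tendsto_neg_powr Llim) simp
    then have "\<forall>\<^sub>F k in sequentially. C * L k powr (2 - \<epsilon>) < 1"
      by (rule order_tendstoD) simp
    with Kb' have "\<forall>\<^sub>F k::nat in sequentially. False"
      by eventually_elim (use Kge in \<open>fastforce dest: order_trans\<close>)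
    then show False by simp
  qed

  \<comment> \<open>Covers of \<open>E\<close> by intervals\<close>
  have Gfin: "finite (G i)" "G i \<noteq> {}" if i: "i \<ge> 1" for i
  proof -
    have "finite {x::real. x \<in> \<int> \<and> 0 \<le> x \<and> x \<le> real (q i)}"
      by (rule finite_int_segment)
    then have "finite ({0..real (q i)} \<inter> \<int>)"
      by (rule finite_subset[rotated]) auto
    then show "finite (G i)" using assms(9) i by simp
    have "(0::real) \<in> {0..real (q i)} \<inter> \<int>" by simp
    then show "G i \<noteq> {}" using assms(9) i by blast
  qed
  have near: "\<exists>g\<in>G i. dist x g \<le> r i" if "x \<in> E" and i: "i \<ge> 1" for x i
  proof -
    have "infdist x (G i) \<le> r i" using that assms(11,12) by auto
    moreover obtain g where "g \<in> G i" "infdist x (G i) = dist x g"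
      using infdist_attains_inf[OF finite_imp_closed[OF Gfin(1)[OF i]] Gfin(2)[OF i]] by blast
    ultimately show ?thesis by auto
  qed
  \<comment> \<open>The induction starts from \<open>G 1\<close> with the empty product
    \<open>K 1 = 1\<close>; each refinement costs a factor 4 and the next factor of
    \<open>K\<close>.\<close>
  have cover: "\<exists>S. finite S \<and> real (card S) \<le> real (card (G 1)) * 4 ^ k * K (Suc k) \<and>
      E \<subseteq> (\<Union>g\<in>S. cball g (r (Suc k)))" for k
  proof (induction k)
    case 0
    have "E \<subseteq> (\<Union>g\<in>G 1. cball g (r 1))"
      using near[of _ 1] by (fastforce simp: dist_commute)
    then show ?case using Gfin(1)[of 1] by (intro exI[of _ "G 1"]) (simp add: K_def)
  next
    case (Suc k)
    then obtain S where S: "finite S" "real (card S) \<le> real (card (G 1)) * 4 ^ k * K (Suc k)"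
      "E \<subseteq> (\<Union>g\<in>S. cball g (r (Suc k)))" by blast
    let ?i = "Suc k" and ?j = "Suc (Suc k)"
    \<comment> \<open>Enlarging \<open>G ?j\<close> to the full lattice drops the endpoints 0 and 1.
      The radius dominates \<open>r ?i + r ?j\<close>.\<close>
    define A where "A y = {g \<in> (\<lambda>x. 1 / real (q ?j) * x) ` \<int>. dist y g \<le> 2 * r ?i}" for y
    define p where "p = real (q ?i) powr (real (M ?i) - \<phi> (real (q ?i)))"
    have qj: "real (q ?j) > 0" and qi: "real (q ?i) > 0"
      using q2[of ?j] q2[of ?i] by simp_all
    have rq: "r ?i * real (q ?j) = p"
      using assms(10) qi by (simp add: p_def qSuc powr_diff powr_minus powr_realpow field_simps)
    have r0: "0 \<le> 2 * r ?i" using req[of ?i] by simp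
    \<comment> \<open>The count is at most 1 + 4p by \<open>rq\<close>; rounding up to 4(1 + p)
      reproduces the factor 1 + p of \<open>K\<close>.\<close>
    have A: "finite (A y)" "real (card (A y)) \<le> 4 * (1 + p)" for y
      using card_scaled_ints_near[OF qj r0, of y] rq by (auto simp: A_def algebra_simps)
    have "E \<subseteq> (\<Union>g\<in>(\<Union>y\<in>S. A y). cball g (r ?j))"
    proof
      fix x assume x: "x \<in> E"
      obtain y where y: "y \<in> S" "dist y x \<le> r ?i" using x S(3) by auto
      obtain g where g: "g \<in> G ?j" "dist x g \<le> r ?j" using near[OF x, of ?j] by auto
      have "dist y g \<le> 2 * r ?i"
        using dist_triangle[of y g x] y(2) g(2) rmono[of ?i] by simp
      then have "g \<in> A y" using g(1) assms(9) by (auto simp: A_def)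
      then show "x \<in> (\<Union>g\<in>(\<Union>y\<in>S. A y). cball g (r ?j))"
        using y(1) g(2) by (auto simp: dist_commute)
    qed
    moreover have "finite (\<Union>y\<in>S. A y)" using S(1) A(1) by simp
    moreover have "real (card (\<Union>y\<in>S. A y)) \<le> real (card (G 1)) * 4 ^ ?i * K ?j"
    proof -
      have "real (card (\<Union>y\<in>S. A y)) \<le> (\<Sum>y\<in>S. real (card (A y)))"
        using of_nat_mono[OF card_UN_le[OF S(1), of A], where 'a = real] by simp
      also have "\<dots> \<le> real (card S) * (4 * (1 + p))"
        by (rule sum_bounded_above) (rule A(2))
      also have "\<dots> \<le> (real (card (G 1)) * 4 ^ k * K (Suc k)) * (4 * (1 + p))"
        by (rule mult_right_mono[OF S(2)]) (simp add: p_def)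
      also have "\<dots> = real (card (G 1)) * 4 ^ ?i * K ?j"
        by (simp add: K_def p_def)
      finally show ?thesis .
    qed
    ultimately show ?case by blast
  qed

  \<comment> \<open>Vanishing measure and the dimension bound\<close>
  have zero: "packing_measure (log_gauge s) E = 0" if s: "s > 2 - \<epsilon>" for s
  proof -
    define N where "N k = real (card (G 1)) * 4 ^ k * (C * L k powr (2 - \<epsilon>))" for k
    show ?thesis
    proof (rule packing_measure_log_gauge_eq_0[OF _ Llim])
      show "s > 0" using s eps2 by simp
      show "\<forall>\<^sub>F k in sequentially. \<exists>S. finite S \<and> real (card S) \<le> N k \<and>
              E \<subseteq> (\<Union>g\<in>S. cball g (exp (- L (Suc k))))"
        using Kb'
      proof eventually_elim
        case (elim k)
        then have "real (card (G 1)) * 4 ^ k * K (Suc k) \<le> N k"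
          unfolding N_def by (intro mult_left_mono) auto
        then show ?case
          using cover[of k] req[of "Suc k"] by (auto intro: order_trans)
      qed
      \<comment> \<open>The two powers of \<open>L k\<close> combine to a negative exponent exactly
        because s > 2 - \<epsilon>; the growth of \<open>L\<close> then beats
        \<open>4 ^ k\<close>.\<close>
      have "summable (\<lambda>k. real (card (G 1)) * C * (4 ^ k * L k powr (- (s - (2 - \<epsilon>)))))"
        using s by (intro summable_mult summ) auto
      also have "(\<lambda>k. real (card (G 1)) * C * (4 ^ k * L k powr (- (s - (2 - \<epsilon>)))))
          = (\<lambda>k. N k * L k powr (- s))"
        by (simp add: N_def powr_diff powr_minus powr_add field_simps)
      finally show "summable (\<lambda>k. N k * L k powr (- s))" .
    qed
  qed
  have le: "log_packing_dim E \<le> ereal (2 - \<epsilon>)"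
  proof (rule ereal_le_epsilon2)
    fix e :: real assume "e > 0"
    then show "log_packing_dim E \<le> ereal (2 - \<epsilon>) + ereal e"
      unfolding log_packing_dim_def
      \<comment> \<open>\<open>zero\<close> needs an exponent strictly above 2 - \<epsilon>; by
        \<open>eps2\<close> the shifted one is also positive, as the infimum requires.\<close>
      by (intro INF_lower2[of "2 - \<epsilon> + e"]) (use eps2 zero in auto)
  qed
  have "ereal (2 - \<epsilon>) < ereal 2"
    using assms(13) by simp
  with le have "log_packing_dim E < ereal 2"
    by (rule le_less_trans)
  with le show ?thesis by simp
qed

end
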